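(* Let $f \in \mathcal{C}_{L}$ (the class of convex functions associated with the lune), $f(z)=z+\sum_{n=2}^{\infty}a_nz^n$, and let $\Gamma_1,\Gamma_2$ be the first two inverse logarithmic coefficients of $f$. Then $$-\frac{4}{21}\le |\Gamma_2|-|\Gamma_1|\le \frac1{12} .$$ Both inequalities are sharp, i.e. for each of the two inequalities there exists $f\in\mathcal{C}_{L}$ for which equality holds.
   Context: Let $\mathbb{D}=\{z\in\mathbb{C}:|z|<1\}$. $\mathcal{A}$ denotes the class of functions $f$ analytic in $\mathbb{D}$ with $f(0)=0$ and $f'(0)=1$, so $f(z)=z+\sum_{n=2}^\infty a_n z^n$; $\mathcal{S}$ is the subclass of univalent functions in $\mathcal{A}$. For analytic functions $g,h$ on $\mathbb{D}$, $g$ is subordinate to $h$, written $g\prec h$, if there is an analytic $\omega$ on $\mathbb{D}$ with $\omega(0)=0$ and $|\omega(z)|<1$ such that $g(z)=h(\omega(z))$ for all $z\in\mathbb{D}$. Let $q(z)=z+\sqrt{1+z^2}$, $z\in\mathbb{D}$, with the branch of the square root chosen so that $q(0)=1$. The class of convex functions associated with the lune (written here $\mathcal{C}_{L}$) is $$\mathcal{C}_{L}=\left\{f\in\mathcal{S}: 1+\frac{zf''(z)}{f'(z)}\prec q(z)\right\}.$$ For $f\in\mathcal{A}$, let $f^{-1}$ be its local inverse near the origin with $f^{-1}(0)=0$. The inverse logarithmic coefficients $\Gamma_n$ of $f$ are defined by $$\log\frac{f^{-1}(w)}{w}=2\sum_{n=1}^\infty \Gamma_n w^n$$ for $w$ in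 a neighborhood of $0$, with the branch of the logarithm satisfying $\log 1=0$. In terms of the Taylor coefficients of $f$, $\Gamma_1=-\frac12 a_2$ and $\Gamma_2=-\frac12 a_3+\frac34 a_2^2$. *)

theory Defs
  imports "HOL-Complex_Analysis.Complex_Analysis"
begin

abbreviation unit_disc :: "complex set" where
  "unit_disc \<equiv> ball 0 1"

definition class_A :: "(complex \<Rightarrow> complex) set" where
  "class_A = {f. f holomorphic_on unit_disc \<and> f 0 = 0 \<and> deriv f 0 = 1}"

definition class_S :: "(complex \<Rightarrow> complex) set" where
  "class_S = {f \<in> class_A. inj_on f unit_disc}"

definition subordinate :: "(complex \<Rightarrow> complex) \<Rightarrow> (complex \<Rightarrow> complex) \<Rightarrow> bool" where
  "subordinate g h \<longleftrightarrow> g holomorphic_on unit_disc \<and> h holomorphic_on unit_disc \<and>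
     (\<exists>\<omega>. \<omega> holomorphic_on unit_disc \<and> \<omega> 0 = 0 \<and>
        (\<forall>z\<in>unit_disc. norm (\<omega> z) < 1 \<and> g z = h (\<omega> z)))"

(* For z in the unit disc, 1 + z^2 lies in the right half-plane, so the principal square
   root is the analytic branch with value 1 at z = 0. *)
definition lune :: "complex \<Rightarrow> complex" where
  "lune z = z + csqrt (1 + z\<^sup>2)"

definition class_C_L :: "(complex \<Rightarrow> complex) set" where
  "class_C_L = {f \<in> class_S. subordinate (\<lambda>z. 1 + z * deriv (deriv f) z / deriv f z) lune}"

definition is_local_inverse :: "(complex \<Rightarrow> complex) \<Rightarrow> (complex \<Rightarrow> complex) \<Rightarrow> bool" where
  "is_local_inverse f g \<longleftrightarrow> g analytic_on {0} \<and> g 0 = 0 \<and>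
     (\<forall>\<^sub>F w in nhds 0. f (g w) = w) \<and> (\<forall>\<^sub>F z in nhds 0. g (f z) = z)"

(* Only the germ at 0 of the chosen function is determined by f; nothing below depends
   on more than this germ. *)
definition local_inverse :: "(complex \<Rightarrow> complex) \<Rightarrow> complex \<Rightarrow> complex" where
  "local_inverse f = (SOME g. is_local_inverse f g)"

(* log (f^{-1}(w) / w) with the removable singularity at w = 0 filled in by log 1 = 0.
   The quotient tends to 1 as w tends to 0, so near 0 the principal branch is the required one. *)
definition log_inverse :: "(complex \<Rightarrow> complex) \<Rightarrow> complex \<Rightarrow> complex" where
  "log_inverse f w = (if w = 0 then 0 else Ln (local_inverse f w / w))"

definition inv_log_coeff :: "(complex \<Rightarrow> complex) \<Rightarrow> nat \<Rightarrow> complex" where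
  "inv_log_coeff f n = fps_nth (fps_expansion (log_inverse f) 0) n / 2"

end

theory Submission
  imports Defs
begin

text \<open>
  Write \<open>1 + z f''(z) / f'(z) = q (\<omega> z)\<close> with \<open>q\<close> the lune function and
  \<open>\<omega> z = c z + d z\<^sup>2 + \<dots>\<close> a Schwarz function. Since \<open>q w = 1 + w + w\<^sup>2 / 2 + \<dots>\<close>, comparing
  coefficients and inverting the power series of \<open>f\<close> give
  \<open>\<Gamma>\<^sub>1 = - c / 4\<close> and \<open>\<Gamma>\<^sub>2 = c\<^sup>2 / 16 - d / 12\<close>
  (\<open>inv_log_coeff_of_Schwarz_function\<close>). Schwarz--Pick applied to \<open>\<omega> z / z\<close> bounds
  \<open>\<bar>d\<bar> \<le> 1 - \<bar>c\<bar>\<^sup>2\<close> (\<open>Schwarz_function_coeffs_bound\<close>), and with \<open>x = \<bar>c\<bar> \<in> [0, 1]\<close> the triangle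
  inequality yields
  \<open>(7 x\<^sup>2 - 4) / 48 \<le> \<bar>\<Gamma>\<^sub>2\<bar> \<le> x\<^sup>2 / 16 + (1 - x\<^sup>2) / 12\<close>. Both estimates of
  \<open>\<bar>\<Gamma>\<^sub>2\<bar> - \<bar>\<Gamma>\<^sub>1\<bar> = \<bar>\<Gamma>\<^sub>2\<bar> - x / 4\<close> follow by completing the square and from \<open>x \<ge> 0\<close>
  (\<open>Schwarz_coeff_functional_bounds\<close>); the lower one is attained at
  \<open>x = 6 / 7\<close>, \<open>d = 13 / 49\<close>, the upper one at \<open>x = 0\<close>, \<open>\<bar>d\<bar> = 1\<close>.

  For sharpness one needs members of the class with prescribed \<open>\<omega>\<close>
  (\<open>class_C_L_member_exists\<close>). If \<open>\<omega> z = z * B z\<close> with \<open>\<bar>B\<bar> < 1\<close>, put \<open>f' = exp P\<close> where \<open>P\<close> is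
  the primitive, vanishing at \<open>0\<close>, of \<open>(q (\<omega> z) - 1) / z\<close>. The only point to check is
  univalence: the elementary bound \<open>\<bar>q w - 1\<bar> \<le> \<bar>w\<bar> (1 + \<bar>w\<bar>)\<close> integrates to
  \<open>\<bar>P\<bar> \<le> 1 + 1 / 2 < \<pi> / 2\<close>, so \<open>f'\<close> has positive real part and \<open>f\<close> is injective by the
  Noshiro--Warschawski theorem.
\<close>

section \<open>Inverse logarithmic coefficients in terms of Taylor coefficients\<close>

lemma fps_compose_nth_1_2_3:
  fixes F G :: "'a :: comm_ring_1 fps"
  assumes "fps_nth G 0 = 0"
  shows "fps_nth (F oo G) 1 = fps_nth F 1 * fps_nth G 1"
    and "fps_nth (F oo G) 2 = fps_nth F 1 * fps_nth G 2 + fps_nth F 2 * fps_nth G 1 ^ 2"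
    and "fps_nth (F oo G) 3 = fps_nth F 1 * fps_nth G 3
           + 2 * fps_nth F 2 * fps_nth G 1 * fps_nth G 2 + fps_nth F 3 * fps_nth G 1 ^ 3"
  using assms
  by (simp_all add: fps_compose_nth numeral_eq_Suc fps_mult_nth algebra_simps)

lemma local_inverse_exists:
  assumes "f \<in> class_S"
  shows "is_local_inverse f (local_inverse f)"
proof -
  have f: "f holomorphic_on unit_disc" "f 0 = 0" "inj_on f unit_disc"
    using assms by (auto simp: class_S_def class_A_def)
  obtain g where g: "g holomorphic_on f ` unit_disc" "\<And>z. z \<in> unit_disc \<Longrightarrow> g (f z) = z"
    using holomorphic_has_inverse[OF f(1) open_ball f(3)] by metis
  have op: "open (f ` unit_disc)"
    by (rule open_mapping_thm3[OF f(1) open_ball f(3)])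
  have 0: "0 \<in> f ` unit_disc"
    using f(2) by (force intro: image_eqI[of _ _ 0])
  have "is_local_inverse f g"
    unfolding is_local_inverse_def
  proof (intro conjI)
    show "g analytic_on {0}"
      using g(1) op 0 analytic_at by blast
    show "g 0 = 0"
      using g(2)[of 0] f(2) by simp
    show "\<forall>\<^sub>F w in nhds 0. f (g w) = w"
      using eventually_nhds_in_open[OF op 0] by eventually_elim (use g(2) in auto)
    show "\<forall>\<^sub>F z in nhds 0. g (f z) = z"
      using eventually_nhds_in_open[OF open_ball, of 0 0 1]
      by (auto elim!: eventually_mono simp: g(2))
  qed
  thus ?thesis
    unfolding local_inverse_def by (rule someI[of "is_local_inverse f" g])
qed

lemma inv_log_coeff_formulas:
  assumes f: "f \<in> class_S" and F: "f has_fps_expansion F"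
  shows "inv_log_coeff f 1 = - fps_nth F 2 / 2"
    and "inv_log_coeff f 2 = - fps_nth F 3 / 2 + 3 / 4 * fps_nth F 2 ^ 2"
proof -
  define g where "g = local_inverse f"
  have g: "g analytic_on {0}" "g 0 = 0" "\<forall>\<^sub>F w in nhds 0. f (g w) = w"
    using local_inverse_exists[OF f] by (auto simp: g_def is_local_inverse_def)
  have F01: "fps_nth F 0 = 0" "fps_nth F 1 = 1"
    using f fps_nth_fps_expansion[OF F, of 0] fps_nth_fps_expansion[OF F, of 1]
    by (auto simp: class_S_def class_A_def)
  define G where "G = fps_expansion g 0"
  have G: "g has_fps_expansion G"
    unfolding G_def by (rule analytic_at_imp_has_fps_expansion_0[OF g(1)])
  have G0: "fps_nth G 0 = 0"
    using has_fps_expansion_imp_0_eq_fps_nth_0[OF G] g(2) by simp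
  have "(f \<circ> g) has_fps_expansion (F oo G)"
    by (rule has_fps_expansion_compose[OF F G G0])
  also have "?this \<longleftrightarrow> (\<lambda>w. w) has_fps_expansion (F oo G)"
    by (rule has_fps_expansion_cong) (use g(3) in auto)
  finally have "F oo G = fps_X"
    using fps_expansion_unique_complex has_fps_expansion_fps_X by blast
  hence "fps_nth (F oo G) n = (if n = 1 then 1 else 0)" for n
    by simp
  \<comment> \<open>Comparing the first three coefficients of \<open>F oo G\<close> with those of the identity
    inverts the series.\<close>
  from this[of 1] this[of 2] this[of 3]
  have G1: "fps_nth G 1 = 1" and G2: "fps_nth G 2 = - fps_nth F 2"
    and "fps_nth G 3 + 2 * fps_nth F 2 * fps_nth G 2 + fps_nth F 3 = 0"
    using F01 fps_compose_nth_1_2_3[OF G0, of F]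
    by (simp_all add: eq_neg_iff_add_eq_0 algebra_simps)
  hence G3: "fps_nth G 3 = 2 * fps_nth F 2 ^ 2 - fps_nth F 3"
    by (simp add: power2_eq_square eq_diff_eq add_eq_0_iff2 algebra_simps)
  \<comment> \<open>The quotient of the inverse by the variable, with its removable singularity filled in.\<close>
  define h where "h = (\<lambda>w. if w = 0 then 1 else g w / w)"
  have "G \<noteq> 0"
    using G1 by auto
  hence "subdegree G \<ge> 1"
    by (intro subdegree_geI) (use G0 in auto)
  hence H: "h has_fps_expansion fps_shift 1 G"
    unfolding h_def using has_fps_expansion_shift[OF G, of 1 1] G1 by (simp cong: if_cong)
  have "(Ln \<circ> h) analytic_on {0}"
    unfolding o_def
    by (intro analytic_on_ln has_fps_expansion_imp_analytic_0[OF H])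
       (auto simp: h_def)
  define \<Lambda> where "\<Lambda> = fps_expansion (Ln \<circ> h) 0"
  have \<Lambda>: "(Ln \<circ> h) has_fps_expansion \<Lambda>"
    unfolding \<Lambda>_def by (rule analytic_at_imp_has_fps_expansion_0) fact
  have \<Lambda>0: "fps_nth \<Lambda> 0 = 0"
    using has_fps_expansion_imp_0_eq_fps_nth_0[OF \<Lambda>] by (simp add: h_def)
  \<comment> \<open>The coefficients of \<open>Ln \<circ> h\<close> are read off from \<open>exp (Ln h) = h\<close>.\<close>
  have "(exp \<circ> (Ln \<circ> h)) has_fps_expansion (fps_exp 1 oo \<Lambda>)"
    by (rule has_fps_expansion_compose[OF has_fps_expansion_exp1 \<Lambda> \<Lambda>0])
  also have "?this \<longleftrightarrow> h has_fps_expansion (fps_exp 1 oo \<Lambda>)"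
  proof (rule has_fps_expansion_cong)
    have "(h \<longlongrightarrow> h 0) (nhds 0)"
      using has_fps_expansion_imp_continuous[OF H] tendsto_at_iff_tendsto_nhds[of h 0]
      by (simp add: continuous_within)
    hence "\<forall>\<^sub>F w in nhds 0. h w \<noteq> 0"
      by (rule tendsto_imp_eventually_ne) (simp add: h_def)
    thus "\<forall>\<^sub>F w in nhds 0. (exp \<circ> (Ln \<circ> h)) w = h w"
      by eventually_elim auto
  qed auto
  finally have "fps_exp 1 oo \<Lambda> = fps_shift 1 G"
    using fps_expansion_unique_complex H by blast
  hence "fps_nth (fps_exp 1 oo \<Lambda>) n = fps_nth G (n + 1)" for n
    by simp
  from this[of 1] this[of 2]
  have L: "fps_nth \<Lambda> 1 = fps_nth G 2" "fps_nth \<Lambda> 2 = fps_nth G 3 - fps_nth G 2 ^ 2 / 2"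
    using fps_compose_nth_1_2_3[OF \<Lambda>0, of "fps_exp 1"]
    by (simp_all add: eq_diff_eq numeral_2_eq_2 numeral_3_eq_3 fact_Suc)
  have "log_inverse f = Ln \<circ> h"
    by (auto simp: log_inverse_def h_def g_def fun_eq_iff)
  hence "fps_expansion (log_inverse f) 0 = \<Lambda>"
    by (simp add: \<Lambda>_def)
  thus "inv_log_coeff f 1 = - fps_nth F 2 / 2"
    and "inv_log_coeff f 2 = - fps_nth F 3 / 2 + 3 / 4 * fps_nth F 2 ^ 2"
    using L G2 G3 by (simp_all add: inv_log_coeff_def field_simps)
qed

section \<open>The first two coefficients of a Schwarz function\<close>

lemma Schwarz_Pick_at_0:
  assumes holB: "B holomorphic_on unit_disc"
    and B1: "\<And>z. z \<in> unit_disc \<Longrightarrow> norm (B z) < 1"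
  shows "norm (deriv B 0) \<le> 1 - norm (B 0) ^ 2"
proof -
  define c where "c = B 0"
  have c: "norm c < 1"
    using B1[of 0] by (simp add: c_def)
  define \<phi> where "\<phi> = Moebius_function 0 c \<circ> B"
  have "\<phi> holomorphic_on unit_disc"
    unfolding \<phi>_def
    by (rule holomorphic_on_compose_gen[OF holB Moebius_function_holomorphic[OF c]])
       (use B1 in auto)
  moreover have "\<phi> 0 = 0"
    by (simp add: \<phi>_def c_def Moebius_function_eq_zero)
  moreover have "norm (\<phi> z) < 1" if "norm z < 1" for z
    unfolding \<phi>_def o_def by (rule Moebius_function_norm_lt_1[OF c B1]) (use that in auto)
  ultimately have *: "norm (deriv \<phi> 0) \<le> 1"
    using Schwarz_Lemma(2)[of \<phi> 0] by simp
  have sq: "cnj c * c = of_real (norm c ^ 2)"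
    by (metis complex_norm_square mult.commute)
  have pos: "1 - norm c ^ 2 > 0"
    using c by (simp add: power_less_one_iff abs_square_less_1)
  have ne: "1 - cnj c * c \<noteq> 0"
    unfolding sq using pos by (metis of_real_1 of_real_diff of_real_eq_0_iff less_irrefl)
  have dB: "(B has_field_derivative deriv B 0) (at 0)"
    using holB by (simp add: holomorphic_derivI)
  have "((\<lambda>z. (B z - c) / (1 - cnj c * B z)) has_field_derivative
          ((deriv B 0 - 0) * (1 - cnj c * B 0) - (B 0 - c) * (0 - cnj c * deriv B 0))
            / ((1 - cnj c * B 0) * (1 - cnj c * B 0))) (at 0)"
    by (intro DERIV_divide DERIV_diff DERIV_cmult DERIV_const dB)
       (use ne in \<open>simp add: c_def\<close>)
  also have "((deriv B 0 - 0) * (1 - cnj c * B 0) - (B 0 - c) * (0 - cnj c * deriv B 0))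
            / ((1 - cnj c * B 0) * (1 - cnj c * B 0)) = deriv B 0 / (1 - cnj c * c)"
    using ne by (simp add: c_def)
  finally have "deriv \<phi> 0 = deriv B 0 / (1 - cnj c * c)"
    by (intro DERIV_imp_deriv) (simp add: \<phi>_def Moebius_function_simple[abs_def] o_def)
  also have "norm \<dots> = norm (deriv B 0) / (1 - norm c ^ 2)"
    unfolding sq norm_divide using pos
    by (metis abs_of_pos norm_of_real of_real_1 of_real_diff)
  finally show ?thesis
    using * pos by (simp add: c_def)
qed

lemma Schwarz_function_coeffs_bound:
  assumes hol: "\<omega> holomorphic_on unit_disc" and \<omega>0: "\<omega> 0 = 0"
    and \<omega>1: "\<And>z. z \<in> unit_disc \<Longrightarrow> norm (\<omega> z) < 1"
    and W: "\<omega> has_fps_expansion W"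
  shows "norm (fps_nth W 2) \<le> 1 - norm (fps_nth W 1) ^ 2"
proof -
  obtain B where B: "B holomorphic_on unit_disc"
      "\<And>z. norm z < 1 \<Longrightarrow> \<omega> z = z * B z" "deriv \<omega> 0 = B 0"
    using Schwarz3[OF hol \<omega>0] by metis
  have "B analytic_on {0}"
    using B(1) analytic_at by (metis centre_in_ball open_ball zero_less_one)
  hence BF: "B has_fps_expansion fps_expansion B 0"
    by (rule analytic_at_imp_has_fps_expansion_0)
  have "(\<lambda>z. z * B z) has_fps_expansion fps_X * fps_expansion B 0"
    by (intro fps_expansion_intros BF)
  also have "?this \<longleftrightarrow> \<omega> has_fps_expansion fps_X * fps_expansion B 0"
    using eventually_nhds_in_open[OF open_ball, of 0 0 1] B(2)
    by (intro has_fps_expansion_cong) (auto elim!: eventually_mono)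
  finally have "W = fps_X * fps_expansion B 0"
    using W fps_expansion_unique_complex by blast
  hence W1: "fps_nth W 1 = B 0" and W2: "fps_nth W 2 = deriv B 0"
    by (simp_all add: fps_expansion_def)
  \<comment> \<open>Either \<open>\<omega>\<close> is a rotation, where \<open>B\<close> is a unimodular constant, or \<open>B\<close> maps the disc
    into itself and Schwarz--Pick applies.\<close>
  show ?thesis
  proof (cases "\<exists>z. norm z < 1 \<and> z \<noteq> 0 \<and> norm (\<omega> z) = norm z \<or> norm (deriv \<omega> 0) = 1")
    case True
    then obtain \<alpha> where \<alpha>: "\<And>z. norm z < 1 \<Longrightarrow> \<omega> z = \<alpha> * z" "norm \<alpha> = 1"
      using Schwarz_Lemma(3)[OF hol \<omega>0, of 0] \<omega>1 by fastforce
    have "(\<lambda>z. \<alpha> * z) has_fps_expansion fps_const \<alpha> * fps_X"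
      by (intro fps_expansion_intros)
    also have "?this \<longleftrightarrow> \<omega> has_fps_expansion fps_const \<alpha> * fps_X"
      using eventually_nhds_in_open[OF open_ball, of 0 0 1] \<alpha>(1)
      by (intro has_fps_expansion_cong) (auto elim!: eventually_mono)
    finally have "W = fps_const \<alpha> * fps_X"
      using W fps_expansion_unique_complex by blast
    thus ?thesis
      using \<alpha>(2) by simp
  next
    case False
    have "norm (B z) < 1" if z: "z \<in> unit_disc" for z
    proof (cases "z = 0")
      case True
      have "norm (deriv \<omega> 0) \<le> 1"
        using Schwarz_Lemma(2)[OF hol \<omega>0, of 0] \<omega>1 by simp
      thus ?thesis
        using False True B(3) by (metis less_eq_real_def)
    next
      case nz: False
      have "norm (\<omega> z) \<le> norm z"
        using Schwarz_Lemma(1)[OF hol \<omega>0, of z] \<omega>1 z by simp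
      hence "norm (\<omega> z) < norm z"
        using False nz z by (metis less_eq_real_def mem_ball_0)
      thus ?thesis
        using B(2)[of z] z nz by (simp add: norm_mult)
    qed
    from Schwarz_Pick_at_0[OF B(1) this] show ?thesis
      unfolding W1 W2 .
  qed
qed

section \<open>Univalence from a derivative with positive real part\<close>

text \<open>If \<open>f a = f b\<close>, the mean value theorem for the real part of \<open>f / (b - a)\<close> on the segment
  from \<open>a\<close> to \<open>b\<close> produces a point where \<open>Re f' = 0\<close>.\<close>

lemma Noshiro_Warschawski:
  assumes "convex S"
    and f': "\<And>z. z \<in> S \<Longrightarrow> (f has_field_derivative f' z) (at z)"
    and pos: "\<And>z. z \<in> S \<Longrightarrow> Re (f' z) > 0"
  shows "inj_on f S"
proof (rule inj_onI, rule ccontr)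
  fix a b assume ab: "a \<in> S" "b \<in> S" "f a = f b" "a \<noteq> b"
  have seg: "closed_segment a b \<subseteq> S"
    using ab \<open>convex S\<close> by (simp add: closed_segment_subset)
  have "((\<lambda>z. f z / (b - a)) has_field_derivative f' u / (b - a)) (at u)"
    if "u \<in> closed_segment a b" for u
    using f'[of u] that seg by (intro DERIV_cdivide) auto
  from complex_mvt_line[OF this]
  obtain u where u: "u \<in> closed_segment a b"
      "Re (f b / (b - a)) - Re (f a / (b - a)) = Re (f' u / (b - a) * (b - a))"
    by blast
  have "Re (f' u) = 0"
    using u(2) ab by simp
  thus False
    using pos[of u] u(1) seg by auto
qed

section \<open>The lune function\<close>

lemma one_plus_square_notin_nonpos_Reals:
  assumes "norm (z :: complex) < 1"
  shows "1 + z\<^sup>2 \<notin> \<real>\<^sub>\<le>\<^sub>0"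
proof
  assume "1 + z\<^sup>2 \<in> \<real>\<^sub>\<le>\<^sub>0"
  hence "Re (1 + z\<^sup>2) \<le> 0"
    by (auto simp: complex_nonpos_Reals_iff)
  moreover have "\<bar>Re (z\<^sup>2)\<bar> \<le> norm (z\<^sup>2)"
    by (rule abs_Re_le_cmod)
  moreover have "norm (z\<^sup>2) < 1"
    using assms by (simp add: norm_power power_less_one_iff)
  ultimately show False
    by simp
qed

lemma csqrt_holomorphic_unit_disc: "(\<lambda>z. csqrt (1 + z\<^sup>2)) holomorphic_on unit_disc"
  using one_plus_square_notin_nonpos_Reals by (intro holomorphic_intros) auto

lemma lune_holomorphic: "lune holomorphic_on unit_disc"
  unfolding lune_def by (intro holomorphic_intros csqrt_holomorphic_unit_disc)

lemma norm_one_plus_csqrt_ge_1: "norm (1 + csqrt z) \<ge> 1"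
  using complex_Re_le_cmod[of "1 + csqrt z"] Re_csqrt[of z] by (simp del: csqrt.simps)

text \<open>The quotient \<open>(lune w - 1) / w\<close>, rationalised so that no division by \<open>w\<close> occurs and the
  value \<open>1\<close> at \<open>w = 0\<close> needs no separate clause.\<close>

definition lune_quot :: "complex \<Rightarrow> complex" where
  "lune_quot w = 1 + w / (1 + csqrt (1 + w\<^sup>2))"

lemma lune_eq: "lune w = 1 + w * lune_quot w"
proof -
  have "1 + csqrt (1 + w\<^sup>2) \<noteq> 0"
    using norm_one_plus_csqrt_ge_1[of "1 + w\<^sup>2"] by auto
  moreover have "csqrt (1 + w\<^sup>2) ^ 2 = 1 + w\<^sup>2"
    by simp
  ultimately show ?thesis
    by (simp add: lune_def lune_quot_def divide_simps) (simp add: algebra_simps flip: power2_eq_square)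
qed

lemma norm_lune_quot_le: "norm (lune_quot w) \<le> 1 + norm w"
proof -
  have "norm (w / (1 + csqrt (1 + w\<^sup>2))) \<le> norm w / 1"
    unfolding norm_divide by (intro divide_left_mono norm_one_plus_csqrt_ge_1) 
      (use norm_one_plus_csqrt_ge_1[of "1 + w\<^sup>2"] in auto)
  thus ?thesis
    unfolding lune_quot_def using norm_triangle_ineq[of 1 "w / (1 + csqrt (1 + w\<^sup>2))"] by simp
qed

lemma lune_quot_holomorphic: "lune_quot holomorphic_on unit_disc"
proof -
  have "1 + csqrt (1 + w\<^sup>2) \<noteq> 0" for w
    using norm_one_plus_csqrt_ge_1[of "1 + w\<^sup>2"] by auto
  thus ?thesis
    unfolding lune_quot_def by (intro holomorphic_intros csqrt_holomorphic_unit_disc)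
qed

section \<open>Members of the class with a prescribed Schwarz function\<close>

text \<open>The constant is the integral of \<open>1 + t\<close> over \<open>[0, 1]\<close>, which dominates the integral
  of \<open>norm (z * p (t * z))\<close>, that is, of \<open>p\<close> along the radius to \<open>z\<close>.\<close>

lemma primitive_norm_le:
  assumes P: "\<And>z. z \<in> unit_disc \<Longrightarrow> (P has_field_derivative p z) (at z)"
    and P0: "P 0 = 0"
    and p: "\<And>z. z \<in> unit_disc \<Longrightarrow> norm (p z) \<le> 1 + norm z"
    and z: "z \<in> unit_disc"
  shows "norm (P z) \<le> 3 / 2"
proof -
  have in_disc: "of_real t * z \<in> unit_disc" if "t \<in> {0..1}" for t :: real
  proof -
    have "\<bar>t\<bar> * norm z \<le> 1 * norm z"
      using that by (intro mult_right_mono) auto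
    thus ?thesis
      using z by (simp add: norm_mult)
  qed
  have D: "((\<lambda>t. P (of_real t * z)) has_vector_derivative z * p (of_real t * z)) (at t)"
    if "t \<in> {0..1}" for t
  proof -
    have "((\<lambda>t. of_real t * z) has_vector_derivative z) (at t)"
      by (auto intro!: derivative_eq_intros)
    from field_vector_diff_chain_at[OF this P[OF in_disc[OF that]]]
    show ?thesis by (simp add: o_def)
  qed
  have "norm (P (of_real 1 * z) - P (of_real 0 * z)) \<le> (1 + 1\<^sup>2 / 2) - (0 + 0\<^sup>2 / 2 :: real)"
  proof (rule differentiable_bound_general[where f' = "\<lambda>t. z * p (of_real t * z)"
                                             and \<phi>' = "\<lambda>t. 1 + t"])
    show "continuous_on {0..1} (\<lambda>t. P (of_real t * z))"
      using D has_vector_derivative_continuous continuous_at_imp_continuous_on by blast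
    show "norm (z * p (of_real t * z)) \<le> 1 + t" if "0 < t" "t < 1" for t
    proof -
      have "norm (z * p (of_real t * z)) \<le> 1 * (1 + norm (of_real t * z))"
        unfolding norm_mult using p[OF in_disc[of t]] that z
        by (intro mult_mono) (auto simp: norm_mult)
      also have "norm (of_real t * z) \<le> t * 1"
        unfolding norm_mult using that z by (intro mult_mono) auto
      finally show ?thesis by simp
    qed
    show "((\<lambda>t. t + t\<^sup>2 / 2) has_vector_derivative 1 + t) (at t)" for t :: real
      by (auto intro!: derivative_eq_intros
               simp flip: has_real_derivative_iff_has_vector_derivative)
  qed (use D in \<open>auto intro!: continuous_intros\<close>)
  thus ?thesis
    by (simp add: P0)
qed

lemma class_C_L_member_exists:
  assumes holB: "B holomorphic_on unit_disc"
    and B1: "\<And>z. z \<in> unit_disc \<Longrightarrow> norm (B z) < 1"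
  obtains f where "f \<in> class_C_L"
    "\<And>z. z \<in> unit_disc \<Longrightarrow> 1 + z * deriv (deriv f) z / deriv f z = lune (z * B z)"
proof -
  have \<omega>1: "norm (z * B z) < 1" if "z \<in> unit_disc" for z
    using that B1[OF that] norm_mult_less[of z 1 "B z" 1] by simp
  define p where "p = (\<lambda>z. B z * lune_quot (z * B z))"
  have hol\<omega>: "(\<lambda>z. z * B z) holomorphic_on unit_disc"
    by (intro holomorphic_intros holB)
  have "(lune_quot \<circ> (\<lambda>z. z * B z)) holomorphic_on unit_disc"
    by (rule holomorphic_on_compose_gen[OF hol\<omega> lune_quot_holomorphic]) (use \<omega>1 in auto)
  hence "p holomorphic_on unit_disc"
    unfolding p_def o_def by (intro holomorphic_intros holB)
  then obtain P0 where P0: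
    "\<And>z. z \<in> unit_disc \<Longrightarrow> (P0 has_field_derivative p z) (at z within unit_disc)"
    using holomorphic_convex_primitive'[of unit_disc p] by (metis convex_ball open_ball)
  define P where "P = (\<lambda>z. P0 z - P0 0)"
  have P: "(P has_field_derivative p z) (at z)" if "z \<in> unit_disc" for z
  proof -
    have "(P0 has_field_derivative p z) (at z)"
      using P0[OF that] at_within_open[OF that] by simp
    thus ?thesis
      unfolding P_def by (auto intro!: derivative_eq_intros)
  qed
  have "norm (p z) \<le> 1 + norm z" if z: "z \<in> unit_disc" for z
  proof -
    have "norm (p z) \<le> 1 * (1 + norm (z * B z))"
      unfolding p_def norm_mult[of "B z"] using B1[OF z]
      by (intro mult_mono norm_lune_quot_le) auto
    also have "norm (z * B z) \<le> norm z * 1"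
      unfolding norm_mult using B1[OF z] by (intro mult_left_mono) auto
    finally show ?thesis by simp
  qed
  hence P_le: "norm (P z) \<le> 3 / 2" if "z \<in> unit_disc" for z
    by (intro primitive_norm_le[of P p z] P that) (auto simp: P_def)
  have "(\<lambda>z. exp (P z)) holomorphic_on unit_disc"
    using P holomorphic_on_open[OF open_ball] by (intro holomorphic_intros) blast
  then obtain f0 where f0:
    "\<And>z. z \<in> unit_disc \<Longrightarrow> (f0 has_field_derivative exp (P z)) (at z within unit_disc)"
    using holomorphic_convex_primitive'[of unit_disc "\<lambda>z. exp (P z)"] by (metis convex_ball open_ball)
  define f where "f = (\<lambda>z. f0 z - f0 0)"
  have f: "(f has_field_derivative exp (P z)) (at z)" if "z \<in> unit_disc" for z
  proof -
    have "(f0 has_field_derivative exp (P z)) (at z)"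
      using f0[OF that] at_within_open[OF that] by simp
    thus ?thesis
      unfolding f_def by (auto intro!: derivative_eq_intros)
  qed
  have f': "deriv f z = exp (P z)" if "z \<in> unit_disc" for z
    by (rule DERIV_imp_deriv[OF f[OF that]])
  have f'': "deriv (deriv f) z = exp (P z) * p z" if "z \<in> unit_disc" for z
  proof -
    have "((\<lambda>z. exp (P z)) has_field_derivative exp (P z) * p z) (at z)"
      by (auto intro!: derivative_eq_intros P[OF that])
    hence "(deriv f has_field_derivative exp (P z) * p z) (at z)"
      by (rule has_field_derivative_transform_within_open[OF _ open_ball that]) (simp add: f')
    thus ?thesis
      by (rule DERIV_imp_deriv)
  qed
  have eq: "1 + z * deriv (deriv f) z / deriv f z = lune (z * B z)" if "z \<in> unit_disc" for z
    using that by (simp add: f' f'' lune_eq p_def)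
  \<comment> \<open>The argument of \<open>f' z\<close> is \<open>Im (P z)\<close>, at most \<open>3 / 2 < pi / 2\<close> in absolute value.\<close>
  have "Re (exp (P z)) > 0" if "z \<in> unit_disc" for z
  proof -
    have "\<bar>Im (P z)\<bar> < pi / 2"
      using abs_Im_le_cmod[of "P z"] P_le[OF that] pi_gt3 by linarith
    thus ?thesis
      using cos_gt_zero_pi[of "Im (P z)"] by (simp add: Re_exp abs_less_iff)
  qed
  hence "inj_on f unit_disc"
    by (intro Noshiro_Warschawski[of unit_disc f "\<lambda>z. exp (P z)"] f) auto
  moreover have "f holomorphic_on unit_disc"
    using f holomorphic_on_open[OF open_ball] by blast
  moreover have "f 0 = 0" "deriv f 0 = 1"
    using f'[of 0] by (simp_all add: f_def P_def)
  ultimately have "f \<in> class_S"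
    by (simp add: class_S_def class_A_def)
  moreover have "subordinate (\<lambda>z. 1 + z * deriv (deriv f) z / deriv f z) lune"
    unfolding subordinate_def
  proof (intro conjI exI ballI)
    have "(lune \<circ> (\<lambda>z. z * B z)) holomorphic_on unit_disc"
      by (rule holomorphic_on_compose_gen[OF hol\<omega> lune_holomorphic]) (use \<omega>1 in auto)
    thus "(\<lambda>z. 1 + z * deriv (deriv f) z / deriv f z) holomorphic_on unit_disc"
      by (rule holomorphic_transform) (simp add: eq)
  qed (use hol\<omega> \<omega>1 eq lune_holomorphic in auto)
  ultimately show ?thesis
    using that[of f] eq by (simp add: class_C_L_def)
qed

section \<open>The coefficient functional in terms of the Schwarz function\<close>

text \<open>The square root in the lune function is expanded through \<open>s\<^sup>2 = 1 + \<omega>\<^sup>2\<close>, \<open>s 0 = 1\<close>; the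
  coefficients of \<open>f\<close> then come from \<open>z f'' = f' (\<omega> + s - 1)\<close>.\<close>

lemma inv_log_coeff_of_Schwarz_function:
  assumes f: "f \<in> class_S"
    and hol\<omega>: "\<omega> holomorphic_on unit_disc" and \<omega>0: "\<omega> 0 = 0"
    and \<omega>1: "\<And>z. z \<in> unit_disc \<Longrightarrow> norm (\<omega> z) < 1"
    and eq: "\<And>z. z \<in> unit_disc \<Longrightarrow> 1 + z * deriv (deriv f) z / deriv f z = lune (\<omega> z)"
    and W: "\<omega> has_fps_expansion W"
  shows "inv_log_coeff f 1 = - fps_nth W 1 / 4"
    and "inv_log_coeff f 2 = fps_nth W 1 ^ 2 / 16 - fps_nth W 2 / 12"
proof -
  have holf: "f holomorphic_on unit_disc" and f1: "deriv f 0 = 1" and inj: "inj_on f unit_disc"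
    using f by (auto simp: class_S_def class_A_def)
  define F where "F = fps_expansion f 0"
  have "f analytic_on {0}"
    using holf analytic_at by (metis centre_in_ball open_ball zero_less_one)
  hence F: "f has_fps_expansion F"
    unfolding F_def by (rule analytic_at_imp_has_fps_expansion_0)
  have F1: "fps_nth F 1 = 1"
    using f1 by (simp add: F_def fps_expansion_def)
  have W0: "fps_nth W 0 = 0"
    using has_fps_expansion_imp_0_eq_fps_nth_0[OF W] \<omega>0 by simp
  define s where "s = (\<lambda>z. csqrt (1 + \<omega> z ^ 2))"
  have "((\<lambda>w. csqrt (1 + w\<^sup>2)) \<circ> \<omega>) holomorphic_on unit_disc"
    by (rule holomorphic_on_compose_gen[OF hol\<omega> csqrt_holomorphic_unit_disc]) (use \<omega>1 in auto)
  hence "s analytic_on {0}"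
    unfolding s_def o_def using analytic_at by (metis centre_in_ball open_ball zero_less_one)
  hence S: "s has_fps_expansion fps_expansion s 0" (is "_ has_fps_expansion ?S")
    by (rule analytic_at_imp_has_fps_expansion_0)
  have S0: "fps_nth ?S 0 = 1"
    by (simp add: fps_expansion_def s_def \<omega>0)
  have "(\<lambda>z. s z * s z) has_fps_expansion ?S * ?S"
    by (intro fps_expansion_intros S)
  moreover have "(\<lambda>z. 1 + \<omega> z * \<omega> z) has_fps_expansion 1 + W * W"
    by (intro fps_expansion_intros W)
  moreover have "s z * s z = 1 + \<omega> z * \<omega> z" for z
    by (simp add: s_def flip: power2_eq_square)
  ultimately have "?S * ?S = 1 + W * W"
    using fps_expansion_unique_complex by simp
  hence "fps_nth (?S * ?S) n = fps_nth (1 + W * W) n" for n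
    by simp
  from this[of 1] this[of 2]
  have S1: "fps_nth ?S 1 = 0" and "2 * fps_nth ?S 2 = fps_nth W 1 ^ 2"
    using S0 W0 by (auto simp: fps_mult_nth numeral_2_eq_2 power2_eq_square)
  hence S2: "fps_nth ?S 2 = fps_nth W 1 ^ 2 / 2"
    by (simp add: field_simps)
  have "(\<lambda>z. z * deriv (deriv f) z) has_fps_expansion fps_X * fps_deriv (fps_deriv F)"
    by (intro fps_expansion_intros F)
  also have "?this \<longleftrightarrow>
      (\<lambda>z. deriv f z * (\<omega> z + s z - 1)) has_fps_expansion fps_X * fps_deriv (fps_deriv F)"
  proof (rule has_fps_expansion_cong)
    have "z * deriv (deriv f) z = deriv f z * (\<omega> z + s z - 1)" if "z \<in> unit_disc" for z
      using eq[OF that] holomorphic_injective_imp_regular[OF holf open_ball inj that]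
      by (simp add: lune_def s_def field_simps)
    thus "\<forall>\<^sub>F z in nhds 0. z * deriv (deriv f) z = deriv f z * (\<omega> z + s z - 1)"
      using eventually_nhds_in_open[OF open_ball, of 0 0 1] by (auto elim!: eventually_mono)
  qed auto
  finally have "(\<lambda>z. deriv f z * (\<omega> z + s z - 1)) has_fps_expansion
      fps_X * fps_deriv (fps_deriv F)" .
  moreover have "(\<lambda>z. deriv f z * (\<omega> z + s z - 1)) has_fps_expansion
      fps_deriv F * (W + ?S - 1)"
    by (intro fps_expansion_intros F W S)
  ultimately have "fps_X * fps_deriv (fps_deriv F) = fps_deriv F * (W + ?S - 1)"
    using fps_expansion_unique_complex by blast
  hence *: "fps_nth (fps_X * fps_deriv (fps_deriv F)) n = fps_nth (fps_deriv F * (W + ?S - 1)) n" for n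
    by simp
  have F2: "fps_nth F 2 = fps_nth W 1 / 2"
    using *[of 1] W0 S0 S1 F1 by (simp add: fps_mult_nth numeral_2_eq_2 field_simps)
  have "6 * fps_nth F 3 = fps_nth W 2 + fps_nth W 1 ^ 2 / 2 + 2 * fps_nth F 2 * fps_nth W 1"
    using *[of 2] W0 S0 S1 S2 F1
    by (simp add: fps_mult_nth numeral_2_eq_2 numeral_3_eq_3 field_simps)
  hence F3: "fps_nth F 3 = fps_nth W 2 / 6 + fps_nth W 1 ^ 2 / 4"
    by (simp add: F2 field_simps power2_eq_square)
  show "inv_log_coeff f 1 = - fps_nth W 1 / 4"
    and "inv_log_coeff f 2 = fps_nth W 1 ^ 2 / 16 - fps_nth W 2 / 12"
    unfolding inv_log_coeff_formulas[OF f F] F2 F3 by (simp_all add: field_simps power2_eq_square)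
qed

lemma Schwarz_coeff_functional_bounds:
  fixes c d :: complex
  assumes c: "norm c \<le> 1" and d: "norm d \<le> 1 - norm c ^ 2"
  shows "- (4 / 21) \<le> norm (c\<^sup>2 / 16 - d / 12) - norm c / 4"
    and "norm (c\<^sup>2 / 16 - d / 12) - norm c / 4 \<le> 1 / 12"
proof -
  define x where "x = norm c"
  have x: "0 \<le> x" "x \<le> 1" "norm d \<le> 1 - x\<^sup>2"
    using assms by (auto simp: x_def)
  have eqs: "norm (c\<^sup>2 / 16) = x\<^sup>2 / 16" "norm (d / 12) = norm d / 12"
    by (simp_all add: norm_divide norm_power x_def)
  have "norm (c\<^sup>2 / 16 - d / 12) \<le> x\<^sup>2 / 16 + norm d / 12"
    using norm_triangle_ineq4[of "c\<^sup>2 / 16" "d / 12"] unfolding eqs .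
  thus "norm (c\<^sup>2 / 16 - d / 12) - norm c / 4 \<le> 1 / 12"
    using x zero_le_power2[of x] unfolding x_def[symmetric] by linarith
  have "norm (c\<^sup>2 / 16 - d / 12) \<ge> x\<^sup>2 / 16 - norm d / 12"
    using norm_triangle_ineq2[of "c\<^sup>2 / 16" "d / 12"] unfolding eqs .
  hence ge: "norm (c\<^sup>2 / 16 - d / 12) \<ge> (7 * x\<^sup>2 - 4) / 48"
    using x by simp
  have "(7 * x\<^sup>2 - 4) / 48 - x / 4 + 4 / 21 = 7 / 48 * (x - 6 / 7)\<^sup>2"
    by (simp add: power2_eq_square field_simps)
  hence "- (4 / 21) \<le> norm (c\<^sup>2 / 16 - d / 12) - x / 4"
    using ge zero_le_power2[of "x - 6 / 7"] by linarith
  thus "- (4 / 21) \<le> norm (c\<^sup>2 / 16 - d / 12) - norm c / 4"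
    by (simp add: x_def)
qed

text \<open>The pairs realised here are those of the Schwarz functions \<open>z * B z\<close>, whose first two
  coefficients are \<open>B 0\<close> and \<open>deriv B 0\<close>.\<close>

lemma inv_log_coeff_value_exists:
  assumes holB: "B holomorphic_on unit_disc"
    and B1: "\<And>z. z \<in> unit_disc \<Longrightarrow> norm (B z) < 1"
  obtains f where "f \<in> class_C_L" "inv_log_coeff f 1 = - B 0 / 4"
    "inv_log_coeff f 2 = B 0 ^ 2 / 16 - deriv B 0 / 12"
proof -
  obtain f where f: "f \<in> class_C_L"
    "\<And>z. z \<in> unit_disc \<Longrightarrow> 1 + z * deriv (deriv f) z / deriv f z = lune (z * B z)"
    using class_C_L_member_exists[OF holB B1] by blast
  have "norm (z * B z) < 1" if "z \<in> unit_disc" for z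
    using that B1[OF that] norm_mult_less[of z 1 "B z" 1] by simp
  moreover have "B analytic_on {0}"
    using holB analytic_at by (metis centre_in_ball open_ball zero_less_one)
  hence "(\<lambda>z. z * B z) has_fps_expansion fps_X * fps_expansion B 0"
    by (intro fps_expansion_intros analytic_at_imp_has_fps_expansion_0)
  moreover have "(\<lambda>z. z * B z) holomorphic_on unit_disc"
    by (intro holomorphic_intros holB)
  moreover have "f \<in> class_S"
    using f(1) by (simp add: class_C_L_def)
  ultimately have "inv_log_coeff f 1 = - B 0 / 4"
    "inv_log_coeff f 2 = B 0 ^ 2 / 16 - deriv B 0 / 12"
    using inv_log_coeff_of_Schwarz_function[of f "\<lambda>z. z * B z" "fps_X * fps_expansion B 0"] f(2)
    by (simp_all add: fps_expansion_def)
  thus ?thesis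
    using that f(1) by blast
qed

section \<open>The sharp estimates\<close>

theorem theorem2p4:
  shows "(\<forall>f\<in>class_C_L.
            - (4 / 21) \<le> norm (inv_log_coeff f 2) - norm (inv_log_coeff f 1) \<and>
            norm (inv_log_coeff f 2) - norm (inv_log_coeff f 1) \<le> 1 / 12) \<and>
         (\<exists>f\<in>class_C_L. norm (inv_log_coeff f 2) - norm (inv_log_coeff f 1) = - (4 / 21)) \<and>
         (\<exists>f\<in>class_C_L. norm (inv_log_coeff f 2) - norm (inv_log_coeff f 1) = 1 / 12)"
proof (intro conjI ballI)
  fix f assume f: "f \<in> class_C_L"
  then obtain \<omega> where \<omega>: "\<omega> holomorphic_on unit_disc" "\<omega> 0 = 0"
      "\<And>z. z \<in> unit_disc \<Longrightarrow> norm (\<omega> z) < 1"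
      "\<And>z. z \<in> unit_disc \<Longrightarrow> 1 + z * deriv (deriv f) z / deriv f z = lune (\<omega> z)"
    by (auto simp: class_C_L_def subordinate_def)
  have "f \<in> class_S"
    using f by (simp add: class_C_L_def)
  define W where "W = fps_expansion \<omega> 0"
  have "\<omega> analytic_on {0}"
    using \<omega>(1) analytic_at by (metis centre_in_ball open_ball zero_less_one)
  hence W: "\<omega> has_fps_expansion W"
    unfolding W_def by (rule analytic_at_imp_has_fps_expansion_0)
  have bound: "norm (fps_nth W 2) \<le> 1 - norm (fps_nth W 1) ^ 2"
    by (rule Schwarz_function_coeffs_bound[OF \<omega>(1-3) W])
  hence "norm (fps_nth W 1) ^ 2 \<le> 1"
    using norm_ge_zero[of "fps_nth W 2"] by linarith
  hence "norm (fps_nth W 1) \<le> 1"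
    by (simp add: power_le_one_iff)
  note Schwarz_coeff_functional_bounds[OF this bound]
  moreover have "norm (inv_log_coeff f 1) = norm (fps_nth W 1) / 4"
    using inv_log_coeff_of_Schwarz_function(1)[OF \<open>f \<in> class_S\<close> \<omega> W]
    by (simp add: norm_divide)
  ultimately show "- (4 / 21) \<le> norm (inv_log_coeff f 2) - norm (inv_log_coeff f 1)"
    and "norm (inv_log_coeff f 2) - norm (inv_log_coeff f 1) \<le> 1 / 12"
    using inv_log_coeff_of_Schwarz_function(2)[OF \<open>f \<in> class_S\<close> \<omega> W] by simp_all
next
  \<comment> \<open>Equality in the lower estimate holds for \<open>c = 6 / 7\<close> and \<open>d = 1 - c\<^sup>2 = 13 / 49\<close>, which
    are the value and the derivative at \<open>0\<close> of the disc automorphism \<open>(z + 6/7) / (1 + 6/7 z)\<close>.\<close>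
  define B where "B = Moebius_function 0 (- 6 / 7)"
  have n67: "norm (- 6 / 7 :: complex) < 1"
    by (simp add: norm_divide)
  have B_eq: "B = (\<lambda>z. (z + 6 / 7) / (1 + 6 / 7 * z))"
    by (simp add: B_def Moebius_function_simple fun_eq_iff)
  have "(B has_field_derivative 13 / 49) (at 0)"
    unfolding B_eq by (auto intro!: derivative_eq_intros simp: field_simps)
  hence "deriv B 0 = 13 / 49"
    by (rule DERIV_imp_deriv)
  moreover have "B 0 = 6 / 7"
    by (simp add: B_eq)
  moreover have "B holomorphic_on unit_disc"
    unfolding B_def by (rule Moebius_function_holomorphic[OF n67])
  moreover have "norm (B z) < 1" if "z \<in> unit_disc" for z
    unfolding B_def by (rule Moebius_function_norm_lt_1[OF n67]) (use that in auto)
  ultimately obtain f where f: "f \<in> class_C_L" "inv_log_coeff f 1 = - (6 / 7) / 4"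
      "inv_log_coeff f 2 = (6 / 7) ^ 2 / 16 - (13 / 49) / 12"
    using inv_log_coeff_value_exists[of B] by metis
  have "inv_log_coeff f 1 = of_real (- 3 / 14)" "inv_log_coeff f 2 = of_real (1 / 42)"
    unfolding f by (simp_all add: power2_eq_square)
  hence "norm (inv_log_coeff f 2) - norm (inv_log_coeff f 1) = - (4 / 21)"
    by (simp only: norm_of_real)
  thus "\<exists>f\<in>class_C_L. norm (inv_log_coeff f 2) - norm (inv_log_coeff f 1) = - (4 / 21)"
    using f(1) by blast
next
  \<comment> \<open>Equality in the upper estimate needs \<open>c = 0\<close> and \<open>\<bar>d\<bar> = 1\<close>, that is
    \<open>\<omega> z = z\<^sup>2\<close> up to a unimodular factor; here \<open>B z = z\<close>.\<close>
  obtain f where f: "f \<in> class_C_L" "inv_log_coeff f 1 = 0" "inv_log_coeff f 2 = - (1 / 12)"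
    using inv_log_coeff_value_exists[of "\<lambda>z. z"] by (auto simp: holomorphic_on_ident)
  thus "\<exists>f\<in>class_C_L. norm (inv_log_coeff f 2) - norm (inv_log_coeff f 1) = 1 / 12"
    by (intro bexI[of _ f]) (simp_all add: norm_divide)
qed

end
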